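(* Let $S\in\{1,2,3,4\}$ and $B\in\{S+1,S+2,S+3,S+4,S+5,S+6,12,16,20,25,30\}$. For each $S$-element subset $A\subset\{0,1,\dots,S+2\}$ let $m_A(t)=\det\bigl(\mathcal R_{a,j}(t)\bigr)_{a\in A,\,1\le j\le S}\in\mathbb Q[t]$. Then all $\binom{S+3}{S}$ polynomials $m_A$ are nonzero, and $\gcd_A m_A=1$ in $\mathbb Q[t]$ (the gcd over all $S$-element subsets $A$). Hence for every $t\in\mathbb C$ the $(S+3)\times S$ matrix $\bigl(\mathcal R_{a,j}(t)\bigr)_{0\le a\le S+2,\,1\le j\le S}$ has rank $S$; in particular, it has rank $S$ at $t=G$, where $G=\sum_{k\ge0}(-1)^k(2k+1)^{-2}$ is Catalan's constant.
   Context: For integers $m\ge 0$ put $S_{m-1}=\sum_{k=0}^{m-1}\frac{(-1)^k}{(2k+1)^2}\in\mathbb Q$ and $u_m(t)=\frac{(-1)^m(t-S_{m-1})}{2m+1}\in\mathbb Q[t]$, a polynomial of degree $1$ in the indeterminate $t$. (At $t=G$ one has $(2m+1)u_m(G)=T_m=\sum_{r\ge0}(-1)^r(2m+2r+1)^{-2}$.) For integers $B>S>0$ and $i\ge 0$ let $\Pi_i=\prod_{h=1}^{B}\bigl(2(h+i)+1\bigr)^2$, and for $0\le a\le S+2$, $1\le j\le S$ let $$\mathcal R_{a,j}(t)=\sum_{i=0}^{a+2B}(-1)^i\binom{a+2B}{i}\Pi_i\,u_{i+j}(t)=\alpha_{a,j}+\beta_{a,j}t,\qquad \alpha_{a,j},\beta_{a,j}\in\mathbb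 Q.$$ *)

theory Defs
  imports
    Complex_Main
    "HOL-Computational_Algebra.Computational_Algebra"
    "HOL-Computational_Algebra.Field_as_Ring"
    "Jordan_Normal_Form.Determinant"
    "Jordan_Normal_Form.DL_Rank"
    "Jordan_Normal_Form.DL_Submatrix"
begin

(* catalan_psum m is the paper's S_{m-1}, a sum of m terms; in particular S_{-1} = 0. *)
definition catalan_psum :: "nat \<Rightarrow> rat" where
  "catalan_psum m = (\<Sum>k<m. (-1) ^ k / (2 * of_nat k + 1)\<^sup>2)"

definition u_poly :: "nat \<Rightarrow> rat poly" where
  "u_poly m = Polynomial.smult ((-1) ^ m / (2 * of_nat m + 1)) ([:0, 1:] - [:catalan_psum m:])"

definition Pi_weight :: "nat \<Rightarrow> nat \<Rightarrow> rat" where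
  "Pi_weight B i = (\<Prod>h=1..B. (2 * (of_nat h + of_nat i) + 1)\<^sup>2)"

definition calR :: "nat \<Rightarrow> nat \<Rightarrow> nat \<Rightarrow> rat poly" where
  "calR B a j =
     (\<Sum>i=0..a + 2 * B. Polynomial.smult ((-1) ^ i * of_nat ((a + 2 * B) choose i) * Pi_weight B i) (u_poly (i + j)))"

(* Matrix indices start at 0, so column c holds the entries with j = c + 1. *)
definition calR_mat :: "nat \<Rightarrow> nat \<Rightarrow> rat poly mat" where
  "calR_mat S B = mat (S + 3) S (\<lambda>(a, c). calR B a (c + 1))"

(* The rows in A are taken in increasing order. *)
definition minor_poly :: "nat \<Rightarrow> nat \<Rightarrow> nat set \<Rightarrow> rat poly" where
  "minor_poly S B A = det (submatrix (calR_mat S B) A UNIV)"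

definition calR_mat_at :: "nat \<Rightarrow> nat \<Rightarrow> complex \<Rightarrow> complex mat" where
  "calR_mat_at S B t = map_mat (\<lambda>p. poly (map_poly of_rat p) t) (calR_mat S B)"

definition catalan_const :: real where
  "catalan_const = (\<Sum>k. (-1) ^ k / (2 * real k + 1)\<^sup>2)"

lemma catalan_const_sums: "(\<lambda>k. (-1) ^ k / (2 * real k + 1)\<^sup>2) sums catalan_const"
proof -
  have "(\<lambda>k. 1 / (2 * real k + 1)\<^sup>2) \<longlonglongrightarrow> 0"
  proof (rule tendsto_sandwich[OF _ _ tendsto_const lim_inverse_n'])
    have "1 / (2 * real k + 1)\<^sup>2 \<le> 1 / real k" if "k > 0" for k
      using that by (intro frac_le) (auto simp: power2_eq_square algebra_simps)
    then show "\<forall>\<^sub>F k in sequentially. 1 / (2 * real k + 1)\<^sup>2 \<le> 1 / real k"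
      by (auto intro: eventually_sequentiallyI[of 1])
  qed simp
  moreover have "monoseq (\<lambda>k. 1 / (2 * real k + 1)\<^sup>2)"
    by (rule monoI2) (auto intro!: divide_left_mono power_mono)
  ultimately have "summable (\<lambda>k. (-1) ^ k * (1 / (2 * real k + 1)\<^sup>2))"
    by (rule summable_Leibniz(1))
  then have "summable (\<lambda>k. (-1) ^ k / (2 * real k + 1)\<^sup>2)"
    by simp
  then show ?thesis
    unfolding catalan_const_def by (rule summable_sums)
qed

end

theory Submission
  imports Defs "Jordan_Normal_Form.Char_Poly" "Jordan_Normal_Form.DL_Rank_Submatrix"
    "HOL-Library.Sublist" "HOL-Number_Theory.Cong"
begin

text \<open>
  The entries of the matrix are linear polynomials, so the matrix is a pencil
  \<open>\<alpha> + t \<beta>\<close> of rational \<open>(S + 3) \<times> S\<close> matrices. Everything follows from two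
  facts about \<open>\<alpha>\<close> and \<open>\<beta>\<close>, both of which say that certain rational matrices have trivial
  kernel, and both of which can be tested modulo one prime \<open>p\<close> that divides no denominator:
  a rational number with nonzero residue is nonzero.

  For the minors it is enough to look at \<open>t = 0\<close>. Gaussian elimination modulo \<open>p\<close>
  shows that any \<open>S\<close> rows of \<open>\<alpha>\<close> are linearly independent, hence
  \<open>m\<^sub>A(0) \<noteq> 0\<close> (lemma \<open>minor_poly_nonzero_if_check_minors\<close>).

  For the rank at a complex number \<open>t\<close>, suppose \<open>(\<alpha> + t \<beta>) v = 0\<close>. Then
  \<open>(v, t v, t\<^sup>2 v)\<close> lies in the kernel of the block matrix with block rows
  \<open>(\<alpha>, \<beta>, 0)\<close> and \<open>(0, \<alpha>, \<beta>)\<close>. This matrix is rational and no longer depends on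
  \<open>t\<close>, so a single elimination modulo \<open>p\<close> shows \<open>v = 0\<close> for all \<open>t\<close> at once
  (lemma \<open>trivial_kernel_if_check_pencil\<close>). One block row would not do: \<open>(\<alpha>, \<beta>)\<close> has
  \<open>S + 3\<close> rows and \<open>2 S\<close> columns, too many columns for \<open>S = 4\<close>, whereas two block rows
  give \<open>2 (S + 3)\<close> rows for \<open>3 S\<close> columns.

  A matrix with trivial kernel has a nonzero maximal minor
  (lemma \<open>exists_nonzero_maximal_minor\<close>), which gives the rank. It also gives the gcd: a
  nonconstant common divisor of the \<open>m\<^sub>A\<close> has a complex root \<open>t\<close>, and all minors would
  vanish there.

  The residues of \<open>\<alpha>\<close> and \<open>\<beta>\<close> are computed from the defining sums by recursions on
  lists. The prime 257 serves all parameters: the denominators are products of odd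
  numbers up to 141.
\<close>

section \<open>Residues of rational numbers\<close>

text \<open>
  The residue of \<open>x\<close> in the local ring of rationals with denominator prime to \<open>p\<close>, as a
  relation: any fraction representing \<open>x\<close> with such a denominator may serve, reduced or not,
  and \<open>r\<close> may be any representative of its class.
\<close>

definition cong_rat :: "int \<Rightarrow> rat \<Rightarrow> int \<Rightarrow> bool" where
  "cong_rat p x r \<longleftrightarrow> (\<exists>a b. \<not> p dvd b \<and> x = of_int a / of_int b \<and> [a = r * b] (mod p))"

abbreviation cong_rats :: "int \<Rightarrow> rat list \<Rightarrow> int list \<Rightarrow> bool" where
  "cong_rats p \<equiv> list_all2 (cong_rat p)"

lemma cong_rat_cong: "cong_rat p x r \<Longrightarrow> [r = s] (mod p) \<Longrightarrow> cong_rat p x s"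
  unfolding cong_rat_def using cong_trans cong_scalar_right by metis

lemma cong_rat_mod [simp]: "cong_rat p x (r mod p) \<longleftrightarrow> cong_rat p x r"
  by (meson cong_rat_cong cong_mod_left cong_refl cong_sym)

lemma cong_rat_not_0:
  assumes "cong_rat p x r" "\<not> p dvd r" "prime p"
  shows "x \<noteq> 0"
proof
  assume "x = 0"
  obtain a b where ab: "\<not> p dvd b" "x = of_int a / of_int b" "[a = r * b] (mod p)"
    using assms(1) unfolding cong_rat_def by blast
  then have "a = 0" using \<open>x = 0\<close> by auto
  with ab(3) have "p dvd r * b" by (metis cong_0_iff cong_sym)
  with ab assms show False by (simp add: prime_dvd_mult_iff)
qed

lemma cong_rat_of_int: "prime p \<Longrightarrow> cong_rat p (of_int k) k"
  unfolding cong_rat_def by (rule exI[of _ k], rule exI[of _ 1]) (auto dest: not_prime_unit)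

lemma cong_rat_inverse:
  assumes "[k * s = 1] (mod p)" "prime p"
  shows "cong_rat p (1 / of_int k) s"
proof -
  have "\<not> p dvd k"
    using assms by (metis cong_dvd_iff dvd_mult2 not_prime_unit)
  then show ?thesis
    unfolding cong_rat_def using cong_sym[OF assms(1)]
    by (intro exI[of _ 1] exI[of _ k]) (auto simp: mult.commute)
qed

lemma cong_rat_add:
  assumes "cong_rat p x r" "cong_rat p y s" "prime p"
  shows "cong_rat p (x + y) (r + s)"
proof -
  obtain a b c d where *: "\<not> p dvd b" "x = of_int a / of_int b" "[a = r * b] (mod p)"
    "\<not> p dvd d" "y = of_int c / of_int d" "[c = s * d] (mod p)"
    using assms unfolding cong_rat_def by blast
  have "[a * d + c * b = r * b * d + s * d * b] (mod p)"
    using * by (intro cong_add cong_mult) auto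
  moreover have "b \<noteq> 0" "d \<noteq> 0"
    using * by auto
  then have "x + y = of_int (a * d + c * b) / of_int (b * d)"
    using * by (simp add: field_simps)
  ultimately show ?thesis
    unfolding cong_rat_def using * assms(3)
    by (intro exI[of _ "a * d + c * b"] exI[of _ "b * d"]) (auto simp: prime_dvd_mult_iff algebra_simps)
qed

lemma cong_rat_mult:
  assumes "cong_rat p x r" "cong_rat p y s" "prime p"
  shows "cong_rat p (x * y) (r * s)"
proof -
  obtain a b c d where *: "\<not> p dvd b" "x = of_int a / of_int b" "[a = r * b] (mod p)"
    "\<not> p dvd d" "y = of_int c / of_int d" "[c = s * d] (mod p)"
    using assms unfolding cong_rat_def by blast
  have "[a * c = (r * b) * (s * d)] (mod p)"
    using * by (intro cong_mult) auto
  then show ?thesis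
    unfolding cong_rat_def using * assms(3)
    by (intro exI[of _ "a * c"] exI[of _ "b * d"]) (auto simp: prime_dvd_mult_iff algebra_simps)
qed

lemma cong_rat_uminus: "cong_rat p x r \<Longrightarrow> prime p \<Longrightarrow> cong_rat p (- x) (- r)"
  using cong_rat_mult[of p "-1" "-1" x r] cong_rat_of_int[of p "-1"] by simp

lemma cong_rat_diff: "cong_rat p x r \<Longrightarrow> cong_rat p y s \<Longrightarrow> prime p \<Longrightarrow> cong_rat p (x - y) (r - s)"
  using cong_rat_add[of p x r "- y" "- s"] cong_rat_uminus[of p y s] by simp

lemma cong_rat_power: "cong_rat p x r \<Longrightarrow> prime p \<Longrightarrow> cong_rat p (x ^ n) (r ^ n)"
  by (induction n) (use cong_rat_of_int[of p 1] cong_rat_mult in auto)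

lemmas cong_rat_intros = cong_rat_add cong_rat_diff cong_rat_mult cong_rat_uminus cong_rat_power

lemma cong_rat_0: "prime p \<Longrightarrow> cong_rat p 0 0"
  using cong_rat_of_int[of p 0] by simp

lemma cong_rat_1: "prime p \<Longrightarrow> cong_rat p 1 1"
  using cong_rat_of_int[of p 1] by simp

section \<open>Elimination modulo a prime\<close>

fun lin_form :: "rat list \<Rightarrow> 'a::field_char_0 list \<Rightarrow> 'a" where
  "lin_form (x # xs) (v # vs) = of_rat x * v + lin_form xs vs"
| "lin_form _ _ = 0"

lemma lin_form_upt:
  "lin_form (map f [0..<n]) (map g [0..<n]) = (\<Sum>l<n. of_rat (f l) * g l)"
proof -
  have "lin_form (map f xs) (map g xs) = (\<Sum>x\<leftarrow>xs. of_rat (f x) * g x)" for xs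
    by (induction xs) auto
  then show ?thesis by (simp add: interv_sum_list_conv_sum_set_nat lessThan_atLeast0)
qed

lemma lin_form_append:
  "length xs = length vs \<Longrightarrow> lin_form (xs @ ys) (vs @ ws) = lin_form xs vs + lin_form ys ws"
  by (induction xs vs rule: list_induct2) (auto simp: add.assoc)

lemma lin_form_zeros: "lin_form (replicate n 0) v = 0"
proof (induction n arbitrary: v)
  case (Suc n)
  then show ?case by (cases v) auto
qed simp

lemma lin_form_scale: "lin_form xs (map ((*) t) vs) = t * lin_form xs vs"
  by (induction xs vs rule: lin_form.induct) (auto simp: algebra_simps)

text \<open>
  The invariant of elimination: the integer row \<open>r\<close> is the reduction of a rational row that
  annihilates \<open>v\<close>. The vector itself need not be rational, so it can carry an arbitrary complex
  parameter and is never reduced.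
\<close>

definition lifts_to_zero :: "int \<Rightarrow> 'a::field_char_0 list \<Rightarrow> int list \<Rightarrow> bool" where
  "lifts_to_zero p v r \<longleftrightarrow> (\<exists>R. cong_rats p R r \<and> lin_form R v = 0)"

fun combine_rows :: "int \<Rightarrow> int \<Rightarrow> int \<Rightarrow> int list \<Rightarrow> int list \<Rightarrow> int list" where
  "combine_rows p a b (x # xs) (y # ys) = (a * y - b * x) mod p # combine_rows p a b xs ys"
| "combine_rows p a b _ _ = []"

definition elim_row :: "int \<Rightarrow> int list \<Rightarrow> int list \<Rightarrow> int list" where
  "elim_row p r s = combine_rows p (hd r) (hd s) (tl r) (tl s)"

lemma length_elim_row: "length r = Suc n \<Longrightarrow> length s = Suc n \<Longrightarrow> length (elim_row p r s) = n"
proof -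
  have "length (combine_rows p a b xs ys) = min (length xs) (length ys)" for a b xs ys
    by (induction p a b xs ys rule: combine_rows.induct) auto
  then show "length r = Suc n \<Longrightarrow> length s = Suc n \<Longrightarrow> length (elim_row p r s) = n"
    by (simp add: elim_row_def)
qed

lemma lin_form_combine:
  "length xs = length ys \<Longrightarrow> length ys = length v \<Longrightarrow>
     lin_form (map2 (\<lambda>x y. a * y - b * x) xs ys) v = of_rat a * lin_form ys v - of_rat b * lin_form xs v"
  by (induction xs ys v rule: list_induct3) (auto simp: algebra_simps of_rat_diff of_rat_mult)

lemma cong_rats_combine:
  assumes "cong_rat p a c" "cong_rat p b d" "prime p"
  shows "length r = length s \<Longrightarrow> cong_rats p R r \<Longrightarrow> cong_rats p S s \<Longrightarrow>
           cong_rats p (map2 (\<lambda>x y. a * y - b * x) R S) (combine_rows p c d r s)"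
proof (induction r s arbitrary: R S rule: list_induct2)
  case (Cons x xs y ys)
  then show ?case
    using assms by (auto simp: list_all2_Cons2 intro!: cong_rat_intros)
qed auto

text \<open>
  Elimination of the first column is carried out on the rational rows and on their residues
  alike, in the division-free form \<open>X \<sqdot> S - Y \<sqdot> R\<close> with the leading entries \<open>X\<close> of \<open>R\<close>
  and \<open>Y\<close> of \<open>S\<close>. The coefficient of the first coordinate of the vector cancels.
\<close>

lemma lifts_to_zero_elim_row:
  assumes r: "lifts_to_zero p (v0 # v) r" and s: "lifts_to_zero p (v0 # v) s"
    and len: "length r = Suc (length v)" "length s = Suc (length v)" and p: "prime p"
  shows "lifts_to_zero p v (elim_row p r s)"
proof -
  obtain x xs where r_eq: "r = x # xs" using len by (cases r) auto
  obtain y ys where s_eq: "s = y # ys" using len by (cases s) auto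
  obtain X Xs where X: "cong_rat p X x" "cong_rats p Xs xs" "of_rat X * v0 + lin_form Xs v = 0"
    using r unfolding lifts_to_zero_def r_eq by (auto simp: list_all2_Cons2)
  obtain Y Ys where Y: "cong_rat p Y y" "cong_rats p Ys ys" "of_rat Y * v0 + lin_form Ys v = 0"
    using s unfolding lifts_to_zero_def s_eq by (auto simp: list_all2_Cons2)
  have lens: "length Xs = length Ys" "length Ys = length v"
    using X Y len r_eq s_eq by (auto dest!: list_all2_lengthD)
  have "lin_form Xs v = - of_rat X * v0" "lin_form Ys v = - of_rat Y * v0"
    using X(3) Y(3) by (simp_all add: eq_neg_iff_add_eq_0 add.commute)
  then have "lin_form (map2 (\<lambda>x y. X * y - Y * x) Xs Ys) v = 0"
    by (simp add: lin_form_combine[OF lens])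
  moreover have "cong_rats p (map2 (\<lambda>a b. X * b - Y * a) Xs Ys) (elim_row p r s)"
    using cong_rats_combine[OF X(1) Y(1) p _ X(2) Y(2)] len by (simp add: elim_row_def r_eq s_eq)
  ultimately show ?thesis
    unfolding lifts_to_zero_def by blast
qed

text \<open>
  Back substitution works because a leading entry with nonzero residue is nonzero as a rational number.
\<close>

lemma lifts_to_zero_pivot:
  assumes "lifts_to_zero p (v0 # v) r" "\<not> p dvd hd r" "prime p"
    and "length r = Suc (length v)" "\<forall>x\<in>set v. x = 0"
  shows "v0 = 0"
proof -
  obtain x xs where r_eq: "r = x # xs" using assms by (cases r) auto
  obtain X Xs where X: "cong_rat p X x" "of_rat X * v0 + lin_form Xs v = 0"
    using assms unfolding lifts_to_zero_def r_eq by (auto simp: list_all2_Cons2)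
  have "lin_form Xs v = 0"
    using assms(5) by (induction Xs v rule: lin_form.induct) auto
  with X cong_rat_not_0[OF X(1)] assms show ?thesis
    by (simp add: r_eq)
qed

fun full_column_rank_mod :: "int \<Rightarrow> nat \<Rightarrow> int list list \<Rightarrow> bool" where
  "full_column_rank_mod p 0 rs = True"
| "full_column_rank_mod p (Suc n) rs = (case List.extract (\<lambda>r. hd r mod p \<noteq> 0) rs of None \<Rightarrow> False
     | Some (us, r, vs) \<Rightarrow> full_column_rank_mod p n (map (elim_row p r) (us @ vs)))"

text \<open>
  By induction on the number of columns, elimination with the pivot row shows that the tail of
  \<open>v\<close> vanishes, and then the pivot row itself shows that the first coordinate vanishes.
\<close>

lemma trivial_kernel_if_full_column_rank_mod:
  fixes v :: "'a::field_char_0 list"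
  assumes "full_column_rank_mod p n rs" "length v = n" "prime p"
    and "\<And>r. r \<in> set rs \<Longrightarrow> length r = n" "\<And>r. r \<in> set rs \<Longrightarrow> lifts_to_zero p v r"
  shows "\<forall>x\<in>set v. x = 0"
  using assms
proof (induction p n rs arbitrary: v rule: full_column_rank_mod.induct)
  case (2 p n rs)
  obtain v0 w where v: "v = v0 # w" "length w = n" using 2(3) by (cases v) auto
  obtain us r vs where ex: "List.extract (\<lambda>r. hd r mod p \<noteq> 0) rs = Some (us, r, vs)"
    and fr: "full_column_rank_mod p n (map (elim_row p r) (us @ vs))"
    using 2(2) by (auto split: option.splits)
  have rs: "rs = us @ r # vs" "\<not> p dvd hd r"
    using extract_SomeE[OF ex] by (auto simp: dvd_eq_mod_eq_0)
  have "\<forall>x\<in>set w. x = 0"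
  proof (rule "2.IH"[OF ex refl refl fr v(2) \<open>prime p\<close>], goal_cases)
    case (1 s)
    then show ?case using rs 2(5) by (auto intro!: length_elim_row)
  next
    case (2 s)
    then obtain t where "t \<in> set rs" "s = elim_row p r t" using rs by auto
    moreover have "r \<in> set rs" using rs by simp
    ultimately show ?case
      using "2.prems" v by (auto intro!: lifts_to_zero_elim_row[of p v0])
  qed
  moreover from this have "v0 = 0"
    using lifts_to_zero_pivot[of p v0 w r] "2.prems" v rs by auto
  ultimately show ?case using v by simp
qed auto

text \<open>
  All sets of \<open>n\<close> rows of width \<open>n\<close> are tested together: those whose first member is
  \<open>r\<close> become sets of \<open>n - 1\<close> rows after one elimination with \<open>r\<close>, so that work is shared
  between all of them. The pivot is always taken in the first column, which makes the test
  sufficient but not necessary.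
\<close>

fun maximal_minors_mod :: "int \<Rightarrow> nat \<Rightarrow> int list list \<Rightarrow> bool" where
  "maximal_minors_mod p 0 rs = True"
| "maximal_minors_mod p (Suc n) [] = True"
| "maximal_minors_mod p (Suc n) (r # rs) = (if length rs < n then True else
     hd r mod p \<noteq> 0 \<and> maximal_minors_mod p n (map (elim_row p r) rs) \<and> maximal_minors_mod p (Suc n) rs)"

lemma trivial_kernel_if_maximal_minors_mod:
  fixes v :: "'a::field_char_0 list"
  assumes "maximal_minors_mod p n rs" "subseq ss rs" "length ss = n" "length v = n" "prime p"
    and "\<And>r. r \<in> set rs \<Longrightarrow> length r = n" "\<And>s. s \<in> set ss \<Longrightarrow> lifts_to_zero p v s"
  shows "\<forall>x\<in>set v. x = 0"
  using assms
proof (induction p n rs arbitrary: v ss rule: maximal_minors_mod.induct)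
  case (3 p n r rs)
  have len: "\<not> length rs < n"
    using list_emb_length[OF "3.prems"(2)] "3.prems"(3) by auto
  with "3.prems"(1) have am: "\<not> p dvd hd r" "maximal_minors_mod p n (map (elim_row p r) rs)"
    "maximal_minors_mod p (Suc n) rs" by (auto simp: dvd_eq_mod_eq_0)
  show ?case
  proof (cases "subseq ss rs")
    case True
    show ?thesis
      by (rule "3.IH"(2)[OF len am(3) True]) (use "3.prems" in auto)
  next
    case False
    then obtain ts where ss: "ss = r # ts" "subseq ts rs"
      using "3.prems"(2) by (auto elim: list_emb.cases)
    obtain v0 w where v: "v = v0 # w" "length w = n" using "3.prems"(4) by (cases v) auto
    have "\<forall>x\<in>set w. x = 0"
    proof (rule "3.IH"(1)[OF len am(2) subseq_map[OF ss(2)]], goal_cases)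
      case (5 s)
      then obtain t where t: "t \<in> set ts" "s = elim_row p r t" by auto
      have "t \<in> set rs" using ss(2) t(1) by (auto elim: list_emb_set)
      then have "length t = Suc n" "length r = Suc n" using "3.prems"(6) by simp_all
      moreover have "lifts_to_zero p (v0 # w) t" "lifts_to_zero p (v0 # w) r"
        using "3.prems"(7) t(1) v ss by simp_all
      ultimately show ?case
        unfolding t(2) using v(2) "3.prems"(5) by (intro lifts_to_zero_elim_row[of p v0]) simp_all
    qed (use "3.prems" v ss in \<open>auto intro!: length_elim_row\<close>)
    moreover from this have "v0 = 0"
      using lifts_to_zero_pivot[of p v0 w r] "3.prems" v am ss by auto
    ultimately show ?thesis using v by simp
  qed
qed auto

section \<open>Maximal minors, rank and gcd\<close>

lemma bij_betw_pick:
  assumes "finite I"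
  shows "bij_betw (pick I) {..<card I} I"
proof -
  have inj: "inj_on (pick I) {..<card I}"
    by (rule inj_onI) (metis card_pick_le lessThan_iff)
  have "pick I ` {..<card I} = I"
  proof (rule card_subset_eq[OF assms])
    show "pick I ` {..<card I} \<subseteq> I" by (auto intro: pick_in_set_le)
    show "card (pick I ` {..<card I}) = card I" by (simp add: card_image[OF inj])
  qed
  with inj show ?thesis by (simp add: bij_betw_def)
qed

text \<open>
  Independent rows are collected greedily. As long as fewer than \<open>k\<close> rows are chosen, they
  have a common nonzero zero \<open>v\<close>; by assumption some row \<open>r\<close> of \<open>M\<close> does not vanish on
  \<open>v\<close>. Evaluating a linear relation at \<open>v\<close> isolates the coefficient of \<open>r\<close>, so \<open>r\<close>
  is independent of the rows chosen before.
\<close>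

lemma exists_independent_rows:
  fixes M :: "'a::field mat"
  assumes M: "M \<in> carrier_mat n k"
    and ker: "\<And>v. v \<in> carrier_vec k \<Longrightarrow> M *\<^sub>v v = 0\<^sub>v n \<Longrightarrow> v = 0\<^sub>v k"
    and "j \<le> k"
  shows "\<exists>I\<subseteq>{..<n}. card I = j \<and>
           (\<forall>c. (\<forall>l<k. (\<Sum>i\<in>I. c i * M $$ (i, l)) = 0) \<longrightarrow> (\<forall>i\<in>I. c i = 0))"
  using \<open>j \<le> k\<close>
proof (induction j)
  case (Suc j)
  then obtain I where I: "I \<subseteq> {..<n}" "card I = j"
    and ind: "\<And>c. \<forall>l<k. (\<Sum>i\<in>I. c i * M $$ (i, l)) = 0 \<Longrightarrow> \<forall>i\<in>I. c i = 0"
    by auto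
  have fin: "finite I" using I(1) finite_subset by blast
  define N where "N = mat k k (\<lambda>(r, l). if r < j then M $$ (pick I r, l) else 0)"
  have N: "N \<in> carrier_mat k k" by (simp add: N_def)
  \<comment> \<open>The rows chosen so far are padded with zero rows, so the square matrix is singular.\<close>
  have "det N = (\<Sum>l<k. N $$ (j, l) * cofactor N j l)"
    using Suc.prems by (intro laplace_expansion_row[OF N]) simp
  also have "\<dots> = 0"
    using Suc.prems by (intro sum.neutral) (auto simp: N_def)
  finally obtain v where v: "v \<in> carrier_vec k" "v \<noteq> 0\<^sub>v k" "N *\<^sub>v v = 0\<^sub>v k"
    using det_0_iff_vec_prod_zero[OF N] by blast
  have zero: "(\<Sum>l<k. M $$ (i, l) * v $ l) = 0" if "i \<in> I" for i
  proof -
    obtain r where r: "r < j" "i = pick I r"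
      using \<open>i \<in> I\<close> bij_betw_pick[OF fin] I(2) by (auto simp: bij_betw_def)
    have "(N *\<^sub>v v) $ r = (\<Sum>l<k. M $$ (i, l) * v $ l)"
      using r Suc.prems v(1) N by (simp add: N_def scalar_prod_def lessThan_atLeast0)
    then show ?thesis using v(3) r(1) Suc.prems by simp
  qed
  have "M *\<^sub>v v \<noteq> 0\<^sub>v n" using ker v by blast
  then obtain r where r: "r < n" "(\<Sum>l<k. M $$ (r, l) * v $ l) \<noteq> 0"
  proof -
    have "\<exists>r<n. (M *\<^sub>v v) $ r \<noteq> 0"
      using \<open>M *\<^sub>v v \<noteq> 0\<^sub>v n\<close> M by (metis carrier_matD(1) dim_mult_mat_vec eq_vecI index_zero_vec)
    then show ?thesis
      using that M v(1) by (auto simp: scalar_prod_def lessThan_atLeast0)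
  qed
  have "r \<notin> I" using zero r(2) by blast
  have "\<forall>i\<in>insert r I. c i = 0" if c: "\<forall>l<k. (\<Sum>i\<in>insert r I. c i * M $$ (i, l)) = 0" for c
  proof -
    have "0 = (\<Sum>l<k. (\<Sum>i\<in>insert r I. c i * M $$ (i, l)) * v $ l)"
      using c by simp
    also have "\<dots> = (\<Sum>i\<in>insert r I. c i * (\<Sum>l<k. M $$ (i, l) * v $ l))"
      by (simp only: sum_distrib_right sum_distrib_left mult.assoc) (rule sum.swap)
    also have "\<dots> = c r * (\<Sum>l<k. M $$ (r, l) * v $ l)"
      using fin \<open>r \<notin> I\<close> zero by simp
    finally have "c r = 0" using r(2) by simp
    with c fin \<open>r \<notin> I\<close> have "\<forall>l<k. (\<Sum>i\<in>I. c i * M $$ (i, l)) = 0" by simp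
    from ind[OF this] \<open>c r = 0\<close> show ?thesis by simp
  qed
  moreover have "insert r I \<subseteq> {..<n}" "card (insert r I) = Suc j"
    using I fin r(1) \<open>r \<notin> I\<close> by auto
  ultimately show ?case by blast
qed auto

text \<open>
  If the square matrix on \<open>k\<close> independent rows were singular, so would be its transpose, and
  a kernel vector of the transpose is a linear relation between these rows.
\<close>

lemma exists_nonzero_maximal_minor:
  fixes M :: "'a::field mat"
  assumes M: "M \<in> carrier_mat n k"
    and ker: "\<And>v. v \<in> carrier_vec k \<Longrightarrow> M *\<^sub>v v = 0\<^sub>v n \<Longrightarrow> v = 0\<^sub>v k"
  shows "\<exists>I\<subseteq>{..<n}. card I = k \<and> det (submatrix M I UNIV) \<noteq> 0"
proof -
  obtain I where I: "I \<subseteq> {..<n}" "card I = k"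
    and ind: "\<And>c. \<forall>l<k. (\<Sum>i\<in>I. c i * M $$ (i, l)) = 0 \<Longrightarrow> \<forall>i\<in>I. c i = 0"
    using exists_independent_rows[OF M ker order.refl] by auto
  have fin: "finite I" using I(1) finite_subset by blast
  define S where "S = submatrix M I UNIV"
  have rows: "{i. i < n \<and> i \<in> I} = I" using I(1) by auto
  have S: "S \<in> carrier_mat k k"
    using M I(2) by (auto simp: S_def dim_submatrix rows intro!: carrier_matI)
  have S_nth: "S $$ (i, l) = M $$ (pick I i, l)" if "i < k" "l < k" for i l
    using M I(2) that by (simp add: S_def submatrix_index rows pick_UNIV)
  have "det S \<noteq> 0"
  proof
    assume "det S = 0"
    then have "det (transpose_mat S) = 0" by (simp add: det_transpose[OF S])
    then obtain w where w: "w \<in> carrier_vec k" "w \<noteq> 0\<^sub>v k" "transpose_mat S *\<^sub>v w = 0\<^sub>v k"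
      using det_0_iff_vec_prod_zero[of "transpose_mat S" k] S by auto
    \<comment> \<open>The coefficient of row \<open>i\<close> sits in \<open>w\<close> at the rank of \<open>i\<close> within \<open>I\<close>.\<close>
    define c where "c i = w $ card {a \<in> I. a < i}" for i
    have c_pick: "c (pick I i) = w $ i" if "i < k" for i
      using that I(2) by (simp add: c_def card_pick_le)
    have "(\<Sum>i\<in>I. c i * M $$ (i, l)) = 0" if "l < k" for l
    proof -
      have "(\<Sum>i\<in>I. c i * M $$ (i, l)) = (\<Sum>i<k. c (pick I i) * M $$ (pick I i, l))"
        using sum.reindex_bij_betw[OF bij_betw_pick[OF fin], of "\<lambda>i. c i * M $$ (i, l)"] I(2) by simp
      also have "\<dots> = (\<Sum>i<k. S $$ (i, l) * w $ i)"
        by (intro sum.cong) (auto simp: c_pick S_nth \<open>l < k\<close>)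
      also have "\<dots> = (transpose_mat S *\<^sub>v w) $ l"
        using S w(1) \<open>l < k\<close> by (simp add: scalar_prod_def lessThan_atLeast0)
      finally show ?thesis using w(3) \<open>l < k\<close> by simp
    qed
    then have zero: "\<forall>i\<in>I. c i = 0" by (intro ind) auto
    have "w $ i = 0" if "i < k" for i
      using c_pick[OF that] zero pick_in_set_le[of i I] that I(2) by auto
    then show False using w(1,2) by (metis carrier_vecD eq_vecI index_zero_vec)
  qed
  then show ?thesis using I by (auto simp: S_def)
qed

lemma rank_if_nonzero_maximal_minor:
  fixes M :: "'a::field mat"
  assumes M: "M \<in> carrier_mat n k" and det: "det (submatrix M I UNIV) \<noteq> 0"
  shows "vec_space.rank n M = k"
  using vec_space.rank_gt_minor[OF M det] vec_space.rank_le_nc[OF M] by simp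

text \<open>
  Over the algebraically closed field of complex numbers a nonconstant gcd has a root, which is a
  common root of all polynomials.
\<close>

lemma Gcd_rat_polys_eq_1:
  fixes F :: "rat poly set"
  assumes "\<And>t::complex. \<exists>q\<in>F. poly (map_poly of_rat q) t \<noteq> 0"
  shows "Gcd F = 1"
proof -
  interpret h: map_poly_comm_ring_hom "of_rat :: rat \<Rightarrow> complex" ..
  have "Gcd F \<noteq> 0"
    using assms[of 0] by (auto simp: Gcd_0_iff)
  moreover have "degree (Gcd F) = 0"
  proof (rule ccontr)
    assume "degree (Gcd F) \<noteq> 0"
    then have "degree (map_poly (of_rat :: rat \<Rightarrow> complex) (Gcd F)) > 0"
      by (simp add: degree_map_poly)
    then obtain t :: complex where t: "poly (map_poly of_rat (Gcd F)) t = 0"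
      using alg_closed_imp_poly_has_root by blast
    obtain q where q: "q \<in> F" "poly (map_poly of_rat q) t \<noteq> 0"
      using assms by blast
    obtain s where "q = Gcd F * s"
      using Gcd_dvd[OF q(1)] by (elim dvdE)
    with q t show False by (simp add: h.hom_mult)
  qed
  ultimately have "is_unit (Gcd F)" by (simp add: is_unit_iff_degree)
  then have "normalize (Gcd F) = 1" by (rule is_unit_normalize)
  then show ?thesis by simp
qed

lemma submatrix_map_mat: "submatrix (map_mat f M) I J = map_mat f (submatrix M I J)"
  by (rule eq_matI) (auto simp: dim_submatrix submatrix_index pick_le)

text \<open>
  Evaluation at \<open>t\<close> is a ring homomorphism and therefore commutes with determinants.
\<close>

lemma poly_minor_poly:
  "poly (map_poly of_rat (minor_poly S B A)) t = det (submatrix (calR_mat_at S B t) A UNIV)"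
proof -
  interpret h: map_poly_comm_ring_hom "of_rat :: rat \<Rightarrow> complex" ..
  interpret ev: comm_ring_hom "\<lambda>p. poly (map_poly (of_rat :: rat \<Rightarrow> complex) p) t"
    by unfold_locales (auto simp: h.hom_add h.hom_mult)
  show ?thesis
    by (simp add: minor_poly_def calR_mat_at_def submatrix_map_mat)
qed

section \<open>Residues of the pencil\<close>

text \<open>
  Modular inversion by the relation \<open>p mod x = p - q \<sqdot> x\<close> with \<open>q = p div x\<close>, which
  modulo \<open>p\<close> reads \<open>x\<inverse> = - q \<sqdot> (p mod x)\<inverse>\<close>.
\<close>

function inv_mod :: "int \<Rightarrow> int \<Rightarrow> int" where
  "inv_mod p x = (if x \<le> 1 then 1 else (let q = p div x in - q * inv_mod p (p - q * x)))"
  by auto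
termination
proof (relation "measure (\<lambda>(p, x). nat x)", goal_cases)
  case (2 p x q)
  have "p - q * x = p mod x" using 2 by (simp add: minus_div_mult_eq_mod)
  with 2 show ?case by simp
qed simp

declare inv_mod.simps [simp del]

lemma inv_mod: "prime p \<Longrightarrow> 0 < x \<Longrightarrow> x < p \<Longrightarrow> [x * inv_mod p x = 1] (mod p)"
proof (induction p x rule: inv_mod.induct)
  case (1 p x)
  show ?case
  proof (cases "x \<le> 1")
    case True
    with 1 have "x = 1" by simp
    then show ?thesis by (simp add: inv_mod.simps[of p 1])
  next
    case False
    define q where "q = p div x"
    define r where "r = p - q * x"
    have r: "r = p mod x" by (simp add: r_def q_def minus_div_mult_eq_mod)
    have "\<not> x dvd p"
      using 1(2-4) False by (auto simp: prime_int_iff dest!: spec[of _ x])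
    then have "r \<noteq> 0" by (simp add: r dvd_eq_mod_eq_0)
    moreover have "0 \<le> r" "r < x"
      using False by (simp_all add: r)
    ultimately have "0 < r" "r < x" by simp_all
    then have "[r * inv_mod p r = 1] (mod p)"
      using 1 False unfolding r_def q_def by simp
    moreover have "x * inv_mod p x = r * inv_mod p r - p * inv_mod p r"
      using False by (simp add: inv_mod.simps[of p x] Let_def r_def q_def algebra_simps)
    then have "[x * inv_mod p x = r * inv_mod p r] (mod p)"
      by (simp add: cong_iff_dvd_diff)
    ultimately show ?thesis by (metis cong_trans)
  qed
qed

fun odd_invs :: "int \<Rightarrow> nat \<Rightarrow> int \<Rightarrow> int list" where
  "odd_invs p 0 x = []"
| "odd_invs p (Suc n) x = inv_mod p x mod p # odd_invs p n (x + 2)"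

text \<open>
  From the residues of \<open>1 / (2 * k + 1)\<close> for consecutive \<open>k\<close>, the next two functions
  produce those of the coefficients of \<open>u_poly k\<close>, the slope being the coefficient of the
  indeterminate. The sign \<open>e\<close> is \<open>(-1) ^ k\<close>, and \<open>s\<close> is the residue of
  \<open>catalan_psum k\<close>.
\<close>

fun slopes :: "int \<Rightarrow> int list \<Rightarrow> int list" where
  "slopes e [] = []"
| "slopes e (r # rs) = e * r # slopes (- e) rs"

fun intercepts :: "int \<Rightarrow> int \<Rightarrow> int \<Rightarrow> int list \<Rightarrow> int list" where
  "intercepts p e s [] = []"
| "intercepts p e s (r # rs) = - (e * r * s) mod p # intercepts p (- e) ((s + e * r * r) mod p) rs"

text \<open>
  The factor \<open>(-1) ^ i * Pi_weight B i\<close> of the summands is obtained at \<open>i = 0\<close> as a product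
  and then from term to term by \<open>weights\<close>, since \<open>Pi_weight B (i + 1) / Pi_weight B i\<close> is
  the square of \<open>(2 * (B + i) + 3) / (2 * i + 3)\<close>. The argument \<open>y\<close> is the numerator of
  this fraction and the list supplies the inverse of its denominator.
\<close>

fun initial_weight :: "int \<Rightarrow> nat \<Rightarrow> int" where
  "initial_weight p 0 = 1"
| "initial_weight p (Suc B) = (2 * int B + 3)\<^sup>2 * initial_weight p B mod p"

fun weights :: "int \<Rightarrow> int \<Rightarrow> int \<Rightarrow> int list \<Rightarrow> int list" where
  "weights p y c [] = [c]"
| "weights p y c (r # rs) = c # weights p (y + 2) (- c * (y * r)\<^sup>2 mod p) rs"

definition reduce_once :: "int \<Rightarrow> int \<Rightarrow> int" where
  "reduce_once p s = (if s < p then s else s - p)"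

text \<open>
  The argument \<open>x\<close> is the left neighbour in the old row of the first entry of the list, with 0
  standing to the left of the whole row.
\<close>

fun next_pascal_row :: "int \<Rightarrow> int \<Rightarrow> int list \<Rightarrow> int list" where
  "next_pascal_row p x [] = [x]"
| "next_pascal_row p x (y # ys) = reduce_once p (x + y) # next_pascal_row p y ys"

fun pascal_row :: "int \<Rightarrow> nat \<Rightarrow> int list" where
  "pascal_row p 0 = [1]"
| "pascal_row p (Suc n) = next_pascal_row p 0 (pascal_row p n)"

fun mult_lists :: "int \<Rightarrow> int list \<Rightarrow> int list \<Rightarrow> int list" where
  "mult_lists p (x # xs) (y # ys) = x * y mod p # mult_lists p xs ys"
| "mult_lists p _ _ = []"

fun dot :: "int list \<Rightarrow> int list \<Rightarrow> int" where
  "dot (x # xs) (y # ys) = x * y + dot xs ys"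
| "dot _ _ = 0"

text \<open>
  The sums for consecutive column indices \<open>j\<close> pair the same weights with ever shorter tails
  of the list of coefficients of \<open>u_poly\<close>.
\<close>

fun shifted_dots :: "int \<Rightarrow> int list \<Rightarrow> nat \<Rightarrow> int list \<Rightarrow> int list" where
  "shifted_dots p ws 0 us = []"
| "shifted_dots p ws (Suc n) us = dot ws us mod p # shifted_dots p ws n (tl us)"

fun table_rows :: "int \<Rightarrow> nat \<Rightarrow> int list \<Rightarrow> int list \<Rightarrow> int list \<Rightarrow> nat \<Rightarrow> int list \<Rightarrow> (int list \<times> int list) list" where
  "table_rows p S ps uc ul 0 cs = []"
| "table_rows p S ps uc ul (Suc n) cs = (let ws = mult_lists p ps cs in
     (shifted_dots p ws S uc, shifted_dots p ws S ul) # table_rows p S ps uc ul n (next_pascal_row p 0 cs))"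

text \<open>
  Row \<open>a\<close> of the table lists the residues of \<open>\<alpha>\<close> and of \<open>\<beta>\<close> in the columns 1 to
  \<open>S\<close>. The largest index of \<open>u_poly\<close> that occurs is \<open>(S + 2) + 2 * B + S\<close>, which
  fixes the number of inverses. The lists of coefficients of \<open>u_poly\<close> start at index 1
  because the columns do.
\<close>

definition residue_table :: "int \<Rightarrow> nat \<Rightarrow> nat \<Rightarrow> (int list \<times> int list) list" where
  "residue_table p S B = (let rs = odd_invs p (2 * B + 2 * S + 3) 1 in
     table_rows p S (weights p (2 * int B + 3) (initial_weight p B) (tl rs))
       (tl (intercepts p 1 0 rs)) (tl (slopes 1 rs)) (S + 3) (pascal_row p (2 * B)))"

definition check_minors :: "int \<Rightarrow> (int list \<times> int list) list \<Rightarrow> nat \<Rightarrow> bool" where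
  "check_minors p T S = maximal_minors_mod p S (map (\<lambda>r. take S (fst r)) (take (S + 3) T))"

text \<open>
  The rows of the block matrix with block rows \<open>(\<alpha>, \<beta>, 0)\<close> and \<open>(0, \<alpha>, \<beta>)\<close>.
\<close>

definition check_pencil :: "int \<Rightarrow> (int list \<times> int list) list \<Rightarrow> nat \<Rightarrow> bool" where
  "check_pencil p T S = full_column_rank_mod p (3 * S)
     (map (\<lambda>r. take S (fst r) @ take S (snd r) @ replicate S 0) (take (S + 3) T) @
      map (\<lambda>r. replicate S 0 @ take S (fst r) @ take S (snd r)) (take (S + 3) T))"

text \<open>
  The table for the largest number of columns contains the tables for all smaller ones, since
  \<open>calR\<close> does not depend on \<open>S\<close>.
\<close>

definition check_pencils :: "int \<Rightarrow> nat \<Rightarrow> nat \<Rightarrow> bool" where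
  "check_pencils p n B = (let T = residue_table p n B in
     list_all (\<lambda>S. check_minors p T S \<and> check_pencil p T S) [1..<Suc n])"

text \<open>
  The list consists of residues of \<open>f k, \<dots>, f (m - 1)\<close>. The recursion along the list, with the
  index moving in step, matches the recursion of the functions above.
\<close>

primrec residues :: "int \<Rightarrow> (nat \<Rightarrow> rat) \<Rightarrow> nat \<Rightarrow> nat \<Rightarrow> int list \<Rightarrow> bool" where
  "residues p f k m [] \<longleftrightarrow> m \<le> k"
| "residues p f k m (x # xs) \<longleftrightarrow> k < m \<and> cong_rat p (f k) x \<and> residues p f (Suc k) m xs"

lemma residues_tl: "residues p f k m xs \<Longrightarrow> residues p f (Suc k) m (tl xs)"
  by (cases xs) auto

lemma residues_imp_cong_rats: "residues p f k m xs \<Longrightarrow> cong_rats p (map f [k..<m]) xs"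
  by (induction xs arbitrary: k) (auto simp: upt_conv_Cons)

section \<open>Correctness of the residues\<close>

lemma residues_odd_invs:
  "prime p \<Longrightarrow> 2 * int (k + n) \<le> p \<Longrightarrow>
     residues p (\<lambda>k. 1 / (2 * of_nat k + 1)) k (k + n) (odd_invs p n (2 * int k + 1))"
proof (induction n arbitrary: k)
  case (Suc n)
  have "cong_rat p (1 / of_int (2 * int k + 1)) (inv_mod p (2 * int k + 1))"
    using Suc.prems by (intro cong_rat_inverse inv_mod) auto
  moreover have "residues p (\<lambda>k. 1 / (2 * of_nat k + 1)) (Suc k) (Suc k + n) (odd_invs p n (2 * int (Suc k) + 1))"
    using Suc.prems by (intro Suc.IH) auto
  ultimately show ?case by (simp add: algebra_simps)
qed simp

lemma residues_slopes:
  assumes "prime p"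
  shows "residues p (\<lambda>k. 1 / (2 * of_nat k + 1)) k m rs \<Longrightarrow>
     residues p (\<lambda>k. coeff (u_poly k) 1) k m (slopes ((-1) ^ k) rs)"
proof (induction rs arbitrary: k)
  case (Cons r rs)
  have "cong_rat p ((-1) ^ k * (1 / (2 * of_nat k + 1))) ((-1) ^ k * r)"
    using Cons.prems cong_rat_of_int[OF assms, of "(-1) ^ k"] assms
    by (intro cong_rat_mult) auto
  with Cons.IH[of "Suc k"] Cons.prems show ?case by (simp add: u_poly_def)
qed simp

lemma residues_intercepts:
  assumes p: "prime p"
  shows "residues p (\<lambda>k. 1 / (2 * of_nat k + 1)) k m rs \<Longrightarrow> cong_rat p (catalan_psum k) s \<Longrightarrow>
     residues p (\<lambda>k. coeff (u_poly k) 0) k m (intercepts p ((-1) ^ k) s rs)"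
proof (induction rs arbitrary: k s)
  case (Cons r rs)
  let ?x = "1 / (2 * of_nat k + 1) :: rat"
  have e: "cong_rat p ((-1) ^ k) ((-1) ^ k)"
    using cong_rat_of_int[OF p, of "(-1) ^ k"] by simp
  have r: "cong_rat p ?x r" using Cons.prems by simp
  have "cong_rat p (- ((-1) ^ k * ?x * catalan_psum k)) (- ((-1) ^ k * r * s))"
    using e r Cons.prems(2) p by (intro cong_rat_uminus cong_rat_mult)
  moreover have "cong_rat p (catalan_psum k + (-1) ^ k * ?x * ?x) (s + (-1) ^ k * r * r)"
    using e r Cons.prems(2) p by (intro cong_rat_add cong_rat_mult)
  then have "cong_rat p (catalan_psum (Suc k)) ((s + (-1) ^ k * r * r) mod p)"
    by (simp add: catalan_psum_def power2_eq_square)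
  with Cons.prems(1) have "residues p (\<lambda>k. coeff (u_poly k) 0) (Suc k) m
      (intercepts p ((-1) ^ Suc k) ((s + (-1) ^ k * r * r) mod p) rs)"
    by (intro Cons.IH) simp_all
  ultimately show ?case using Cons.prems(1) by (simp add: u_poly_def)
qed simp

lemma Pi_weight_Suc:
  "Pi_weight B (Suc i) * (2 * of_nat (Suc i) + 1)\<^sup>2 = Pi_weight B i * (2 * of_nat (B + i) + 3)\<^sup>2"
proof (induction B)
  case (Suc B)
  have "Pi_weight (Suc B) (Suc i) * (2 * of_nat (Suc i) + 1)\<^sup>2 =
      (Pi_weight B (Suc i) * (2 * of_nat (Suc i) + 1)\<^sup>2) * (2 * of_nat (Suc B + i) + 3)\<^sup>2"
    by (simp add: Pi_weight_def algebra_simps)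
  also have "\<dots> = Pi_weight B i * (2 * of_nat (B + i) + 3)\<^sup>2 * (2 * of_nat (Suc B + i) + 3)\<^sup>2"
    by (simp only: Suc.IH)
  also have "Pi_weight B i * (2 * of_nat (B + i) + 3)\<^sup>2 = Pi_weight (Suc B) i"
    by (simp add: Pi_weight_def algebra_simps)
  finally show ?case .
qed (simp add: Pi_weight_def)

lemma cong_rat_initial_weight: "prime p \<Longrightarrow> cong_rat p (Pi_weight B 0) (initial_weight p B)"
proof (induction B)
  case (Suc B)
  have "cong_rat p (of_int (2 * int B + 3)) (2 * int B + 3)"
    by (rule cong_rat_of_int) fact
  then have "cong_rat p ((of_int (2 * int B + 3))\<^sup>2 * Pi_weight B 0) ((2 * int B + 3)\<^sup>2 * initial_weight p B)"
    using Suc by (intro cong_rat_intros) auto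
  then show ?case by (simp add: Pi_weight_def algebra_simps)
qed (simp add: Pi_weight_def cong_rat_1)

lemma residues_weights:
  assumes p: "prime p"
  shows "residues p (\<lambda>k. 1 / (2 * of_nat k + 1)) (Suc k) m rs \<Longrightarrow> k < m \<Longrightarrow>
     cong_rat p ((-1) ^ k * Pi_weight B k) c \<Longrightarrow>
     residues p (\<lambda>i. (-1) ^ i * Pi_weight B i) k m (weights p (2 * int (B + k) + 3) c rs)"
proof (induction rs arbitrary: k c)
  case (Cons r rs)
  let ?y = "2 * int (B + k) + 3" and ?x = "1 / (2 * of_nat (Suc k) + 1) :: rat"
  have y: "cong_rat p (of_int ?y) ?y" by (rule cong_rat_of_int[OF p])
  have r: "cong_rat p ?x r" using Cons.prems(1) by simp
  have "cong_rat p (- ((-1) ^ k * Pi_weight B k) * (of_int ?y * ?x)\<^sup>2) (- c * (?y * r)\<^sup>2)"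
    using y r Cons.prems(3) p by (intro cong_rat_intros)
  moreover have "Pi_weight B (Suc k) = Pi_weight B k * (of_int ?y * ?x)\<^sup>2"
  proof -
    have "(0 :: rat) < 2 * of_nat (Suc k) + 1"
      by (simp add: add_pos_nonneg)
    moreover have "X = P * (y * (1 / d))\<^sup>2" if "X * d\<^sup>2 = P * y\<^sup>2" "0 < d" for X P y d :: rat
      using that by (simp add: power_divide field_simps)
    moreover have "of_int ?y = 2 * rat_of_nat (B + k) + 3" by simp
    ultimately show ?thesis
      using Pi_weight_Suc[of B k] by metis
  qed
  ultimately have "cong_rat p ((-1) ^ Suc k * Pi_weight B (Suc k)) (- c * (?y * r)\<^sup>2 mod p)"
    by (simp add: mult.assoc)
  then have "residues p (\<lambda>i. (-1) ^ i * Pi_weight B i) (Suc k) m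
      (weights p (2 * int (B + Suc k) + 3) (- c * (?y * r)\<^sup>2 mod p) rs)"
    using Cons.prems(1) by (intro Cons.IH) auto
  then show ?case using Cons.prems by (simp add: algebra_simps)
qed simp

lemma cong_rat_reduce_once [simp]: "cong_rat p x (reduce_once p s) \<longleftrightarrow> cong_rat p x s"
proof -
  have "reduce_once p s mod p = s mod p" by (simp add: reduce_once_def)
  then show ?thesis by (metis cong_rat_mod)
qed

lemma residues_next_row:
  assumes p: "prime p"
  shows "residues p (\<lambda>i. of_nat (n choose i)) k (Suc n) ys \<Longrightarrow> k \<le> Suc n \<Longrightarrow>
     cong_rat p (if k = 0 then 0 else of_nat (n choose (k - 1))) x \<Longrightarrow>
     residues p (\<lambda>i. of_nat (Suc n choose i)) k (Suc (Suc n)) (next_pascal_row p x ys)"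
proof (induction ys arbitrary: k x)
  case (Cons y ys)
  have "cong_rat p ((if k = 0 then 0 else of_nat (n choose (k - 1))) + of_nat (n choose k)) (x + y)"
    using Cons.prems p by (intro cong_rat_intros) auto
  then have "cong_rat p (of_nat (Suc n choose k)) (x + y)"
    by (cases k) auto
  moreover have "residues p (\<lambda>i. of_nat (Suc n choose i)) (Suc k) (Suc (Suc n)) (next_pascal_row p y ys)"
    using Cons.prems by (intro Cons.IH) auto
  ultimately show ?case using Cons.prems by simp
next
  case Nil
  then have "k = Suc n" by simp
  with Nil show ?case by simp
qed

lemma residues_pascal_row:
  "prime p \<Longrightarrow> residues p (\<lambda>i. of_nat (n choose i)) 0 (Suc n) (pascal_row p n)"
proof (induction n)
  case (Suc n)
  then show ?case by (auto intro!: residues_next_row simp: cong_rat_0)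
qed (simp add: cong_rat_1)

lemma residues_mult_lists:
  assumes "prime p"
  shows "residues p f k m xs \<Longrightarrow> residues p g k m' ys \<Longrightarrow> m' \<le> m \<Longrightarrow>
     residues p (\<lambda>i. f i * g i) k m' (mult_lists p xs ys)"
  using assms by (induction p xs ys arbitrary: k rule: mult_lists.induct) (auto intro: cong_rat_mult)

lemma cong_rat_dot:
  assumes p: "prime p"
  shows "residues p w a b ws \<Longrightarrow> residues p u (a + j) c us \<Longrightarrow> b + j \<le> c \<Longrightarrow>
     cong_rat p (\<Sum>i=a..<b. w i * u (i + j)) (dot ws us)"
proof (induction ws us arbitrary: a rule: dot.induct)
  case (1 x xs y ys)
  have "cong_rat p (w a * u (a + j) + (\<Sum>i=Suc a..<b. w i * u (i + j))) (x * y + dot xs ys)"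
    using 1 p by (intro cong_rat_intros) auto
  then show ?case using 1 by (simp add: sum.atLeast_Suc_lessThan)
qed (auto simp: cong_rat_0[OF p])

lemma residues_dots:
  assumes p: "prime p"
  shows "residues p w 0 b ws \<Longrightarrow> residues p u j c us \<Longrightarrow> b + j + n \<le> Suc c \<Longrightarrow>
     residues p (\<lambda>j. \<Sum>i=0..<b. w i * u (i + j)) j (j + n) (shifted_dots p ws n us)"
proof (induction n arbitrary: j us)
  case (Suc n)
  have "residues p (\<lambda>j. \<Sum>i=0..<b. w i * u (i + j)) (Suc j) (Suc j + n) (shifted_dots p ws n (tl us))"
    using Suc.prems by (intro Suc.IH residues_tl) auto
  moreover have "cong_rat p (\<Sum>i=0..<b. w i * u (i + j)) (dot ws us)"
    using Suc.prems by (intro cong_rat_dot[OF p]) auto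
  ultimately show ?case by simp
qed simp

lemma coeff_calR:
  "coeff (calR B a j) n = (\<Sum>i=0..<Suc (a + 2 * B).
     (-1) ^ i * Pi_weight B i * of_nat ((a + 2 * B) choose i) * coeff (u_poly (i + j)) n)"
  unfolding calR_def coeff_sum coeff_smult atLeastLessThanSuc_atLeastAtMost
  by (intro sum.cong) (simp_all add: mult_ac)

lemma calR_eq: "calR B a j = [:coeff (calR B a j) 0, coeff (calR B a j) 1:]"
proof (rule poly_eqI)
  fix n
  have "coeff (u_poly m) (Suc (Suc n)) = 0" for m n by (simp add: u_poly_def)
  then have "coeff (calR B a j) (Suc (Suc n)) = 0" for n by (simp add: coeff_calR)
  then show "coeff (calR B a j) n = coeff [:coeff (calR B a j) 0, coeff (calR B a j) 1:] n"
    by (cases n rule: nat.exhaust; cases "n - 1") (auto simp: coeff_pCons split: nat.splits)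
qed

lemma poly_calR:
  "poly (map_poly of_rat (calR B a j)) t = of_rat (coeff (calR B a j) 0) + of_rat (coeff (calR B a j) 1) * (t :: complex)"
  by (subst calR_eq) (simp add: Polynomial.map_poly_pCons mult.commute)

lemma residues_table_rows:
  assumes p: "prime p"
    and ps: "residues p (\<lambda>i. (-1) ^ i * Pi_weight B i) 0 N ps"
    and uc: "residues p (\<lambda>k. coeff (u_poly k) 0) 1 N uc"
    and ul: "residues p (\<lambda>k. coeff (u_poly k) 1) 1 N ul"
  shows "residues p (\<lambda>i. of_nat ((a + 2 * B) choose i)) 0 (Suc (a + 2 * B)) cs \<Longrightarrow> a + n + 2 * B + S \<le> N \<Longrightarrow>
     list_all2 (\<lambda>a r. residues p (\<lambda>j. coeff (calR B a j) 0) 1 (1 + S) (fst r) \<and>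
                      residues p (\<lambda>j. coeff (calR B a j) 1) 1 (1 + S) (snd r))
       [a..<a + n] (table_rows p S ps uc ul n cs)"
proof (induction n arbitrary: a cs)
  case (Suc n)
  let ?ws = "mult_lists p ps cs"
  have ws: "residues p (\<lambda>i. (-1) ^ i * Pi_weight B i * of_nat ((a + 2 * B) choose i)) 0 (Suc (a + 2 * B)) ?ws"
    using Suc.prems by (intro residues_mult_lists[OF p ps]) auto
  have "residues p (\<lambda>j. coeff (calR B a j) 0) 1 (1 + S) (shifted_dots p ?ws S uc)"
    "residues p (\<lambda>j. coeff (calR B a j) 1) 1 (1 + S) (shifted_dots p ?ws S ul)"
    unfolding coeff_calR using Suc.prems
    by (intro residues_dots[OF p ws uc] residues_dots[OF p ws ul]; simp)+
  moreover have "residues p (\<lambda>i. of_nat (Suc (a + 2 * B) choose i)) 0 (Suc (Suc (a + 2 * B))) (next_pascal_row p 0 cs)"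
    using Suc.prems by (intro residues_next_row[OF p]) (auto simp: cong_rat_0[OF p])
  then have "list_all2 (\<lambda>a r. residues p (\<lambda>j. coeff (calR B a j) 0) 1 (1 + S) (fst r) \<and>
                      residues p (\<lambda>j. coeff (calR B a j) 1) 1 (1 + S) (snd r))
       [Suc a..<Suc a + n] (table_rows p S ps uc ul n (next_pascal_row p 0 cs))"
    using Suc.prems by (intro Suc.IH) auto
  moreover have "[a..<a + Suc n] = a # [Suc a..<Suc a + n]"
    by (simp add: upt_conv_Cons del: upt_Suc)
  ultimately show ?case by (simp add: Let_def del: upt_Suc)
qed simp

lemma residue_table:
  assumes p: "prime p" and size: "2 * int (2 * B + 2 * S + 3) \<le> p"
  shows "list_all2 (\<lambda>a r. residues p (\<lambda>j. coeff (calR B a j) 0) 1 (1 + S) (fst r) \<and>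
                          residues p (\<lambda>j. coeff (calR B a j) 1) 1 (1 + S) (snd r))
           [0..<S + 3] (residue_table p S B)"
proof -
  define N where "N = 2 * B + 2 * S + 3"
  define rs where "rs = odd_invs p N 1"
  have rs: "residues p (\<lambda>k. 1 / (2 * of_nat k + 1)) 0 N rs"
    using residues_odd_invs[OF p, of 0 N] size by (simp add: rs_def N_def)
  have "residues p (\<lambda>i. (-1) ^ i * Pi_weight B i) 0 N
      (weights p (2 * int B + 3) (initial_weight p B) (tl rs))"
    using residues_weights[OF p, of 0 N "tl rs" B] residues_tl[OF rs] cong_rat_initial_weight[OF p]
    by (simp add: N_def)
  moreover have "residues p (\<lambda>k. coeff (u_poly k) 0) 1 N (tl (intercepts p 1 0 rs))"
    using residues_tl[OF residues_intercepts[OF p rs]] cong_rat_0[OF p] by (simp add: catalan_psum_def)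
  moreover have "residues p (\<lambda>k. coeff (u_poly k) 1) 1 N (tl (slopes 1 rs))"
    using residues_tl[OF residues_slopes[OF p rs]] by simp
  ultimately show ?thesis
    using residues_table_rows[OF p, of B N _ _ _ 0 "pascal_row p (2 * B)" "S + 3" S]
      residues_pascal_row[OF p, of "2 * B"]
    by (simp add: residue_table_def Let_def rs_def N_def add.commute)
qed

section \<open>Nondegeneracy of the pencil\<close>

text \<open>
  Row \<open>a\<close> of \<open>\<alpha>\<close> for \<open>n = 0\<close> and of \<open>\<beta>\<close> for \<open>n = 1\<close>.
\<close>

definition rat_row :: "nat \<Rightarrow> nat \<Rightarrow> nat \<Rightarrow> nat \<Rightarrow> rat list" where
  "rat_row S B n a = map (\<lambda>l. coeff (calR B a (Suc l)) n) [0..<S]"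

lemma residue_table_nth:
  assumes p: "prime p" and size: "2 * int (2 * B + 2 * n + 3) \<le> p" and S: "S \<le> n"
  shows "length (take (S + 3) (residue_table p n B)) = S + 3"
    and "a < S + 3 \<Longrightarrow> cong_rats p (rat_row S B 0 a) (take S (fst (residue_table p n B ! a)))"
    and "a < S + 3 \<Longrightarrow> cong_rats p (rat_row S B 1 a) (take S (snd (residue_table p n B ! a)))"
proof -
  note tab = residue_table[OF p size]
  show "length (take (S + 3) (residue_table p n B)) = S + 3"
    using list_all2_lengthD[OF tab] S by simp
  have row: "cong_rats p (map (\<lambda>l. f (Suc l)) [0..<S]) (take S xs)"
    if "residues p f 1 (1 + n) xs" for f xs
  proof -
    have "cong_rats p (take S (map f [1..<1 + n])) (take S xs)"
      using residues_imp_cong_rats[OF that] by (rule list_all2_takeI)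
    moreover have "take S (map f [1..<1 + n]) = map (\<lambda>l. f (Suc l)) [0..<S]"
      using S by (simp add: take_map take_upt map_Suc_upt[symmetric] del: map_Suc_upt upt_Suc)
    ultimately show ?thesis by simp
  qed
  assume "a < S + 3"
  with list_all2_nthD[OF tab, of a] S
  have "residues p (\<lambda>j. coeff (calR B a j) 0) 1 (1 + n) (fst (residue_table p n B ! a))"
    "residues p (\<lambda>j. coeff (calR B a j) 1) 1 (1 + n) (snd (residue_table p n B ! a))"
    by simp_all
  then show "cong_rats p (rat_row S B 0 a) (take S (fst (residue_table p n B ! a)))"
    "cong_rats p (rat_row S B 1 a) (take S (snd (residue_table p n B ! a)))"
    unfolding rat_row_def
    by (simp_all only: row[of "\<lambda>j. coeff (calR B a j) 0"] row[of "\<lambda>j. coeff (calR B a j) 1"])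
qed

lemma calR_mat_at_carrier: "calR_mat_at S B t \<in> carrier_mat (S + 3) S"
  by (simp add: calR_mat_at_def calR_mat_def)

lemma calR_mat_at_mult_vec:
  assumes "v \<in> carrier_vec S" "a < S + 3"
  shows "(calR_mat_at S B t *\<^sub>v v) $ a =
    lin_form (rat_row S B 0 a) (map (($) v) [0..<S]) + t * lin_form (rat_row S B 1 a) (map (($) v) [0..<S])"
  using assms
  by (simp add: calR_mat_at_def calR_mat_def scalar_prod_def poly_calR rat_row_def lin_form_upt
      lessThan_atLeast0 sum_distrib_left sum.distrib algebra_simps)

lemma vec_eq_0_iff_list: "v \<in> carrier_vec S \<Longrightarrow> v = 0\<^sub>v S \<longleftrightarrow> (\<forall>x\<in>set (map (($) v) [0..<S]). x = 0)"
  by (auto intro!: eq_vecI)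

text \<open>
  It suffices that the minor does not vanish at \<open>t = 0\<close>. If it did, the rows of \<open>\<alpha>\<close> in
  \<open>A\<close> would annihilate a nonzero vector, against the test of all sets of \<open>S\<close> rows.
\<close>

lemma minor_poly_nonzero_if_check_minors:
  assumes p: "prime p" and size: "2 * int (2 * B + 2 * n + 3) \<le> p" and S: "S \<le> n"
    and check: "check_minors p (residue_table p n B) S"
    and A: "A \<subseteq> {0..S + 2}" "card A = S"
  shows "minor_poly S B A \<noteq> 0"
proof
  assume "minor_poly S B A = 0"
  define T where "T = residue_table p n B"
  define M where "M = calR_mat_at S B 0"
  note tab = residue_table_nth[OF p size S, folded T_def]
  have M: "M \<in> carrier_mat (S + 3) S" by (simp add: M_def calR_mat_at_carrier)
  have rows: "{i. i < S + 3 \<and> i \<in> A} = A" using A(1) by auto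
  have sub: "submatrix M A UNIV \<in> carrier_mat S S"
    using carrier_matD[OF M] by (intro carrier_matI) (simp_all add: dim_submatrix rows A(2))
  have "det (submatrix M A UNIV) = 0"
    using \<open>minor_poly S B A = 0\<close> poly_minor_poly[of S B A 0] by (simp add: M_def)
  then obtain v where v: "v \<in> carrier_vec S" "v \<noteq> 0\<^sub>v S" "submatrix M A UNIV *\<^sub>v v = 0\<^sub>v S"
    using det_0_iff_vec_prod_zero[OF sub] by blast
  define vs where "vs = map (($) v) [0..<S]"
  define rs where "rs = map (\<lambda>a. take S (fst (T ! a))) [0..<S + 3]"
  have rs: "map (\<lambda>r. take S (fst r)) (take (S + 3) T) = rs"
    using tab(1) by (auto simp: rs_def intro!: nth_equalityI)
  have zero: "lifts_to_zero p vs (take S (fst (T ! a)))" if "a \<in> A" for a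
  proof -
    have fin: "finite A" using A(1) by (rule finite_subset) simp
    have "a \<in> pick A ` {..<S}"
      using that bij_betw_imp_surj_on[OF bij_betw_pick[OF fin]] A(2) by simp
    then obtain i where i: "i < S" "a = pick A i" by auto
    have a: "a < S + 3" using that A(1) by auto
    have "(submatrix M A UNIV *\<^sub>v v) $ i = (M *\<^sub>v v) $ a"
      using i a M v(1) sub A(2) by (simp add: scalar_prod_def submatrix_index rows pick_UNIV)
    also have "\<dots> = lin_form (rat_row S B 0 a) vs"
      using a v(1) by (simp add: M_def vs_def calR_mat_at_mult_vec)
    finally have "lin_form (rat_row S B 0 a) vs = 0" using v(3) i by simp
    then show ?thesis unfolding lifts_to_zero_def using tab(2)[OF a] by blast
  qed
  define ss where "ss = map (\<lambda>a. take S (fst (T ! a))) (filter (\<lambda>a. a \<in> A) [0..<S + 3])"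
  have "\<forall>x\<in>set vs. x = 0"
  proof (rule trivial_kernel_if_maximal_minors_mod[OF _ _ _ _ p])
    show "maximal_minors_mod p S rs" using check by (simp add: check_minors_def T_def[symmetric] rs)
    show "subseq ss rs" unfolding ss_def rs_def by (intro subseq_map subseq_filter_left)
    have "length ss = card (set (filter (\<lambda>a. a \<in> A) [0..<S + 3]))"
      by (subst distinct_card) (auto simp: ss_def)
    also have "set (filter (\<lambda>a. a \<in> A) [0..<S + 3]) = A" using A(1) by auto
    finally show "length ss = S" using A(2) by simp
    show "length r = S" if "r \<in> set rs" for r
      using that list_all2_lengthD[OF tab(2)] by (auto simp: rs_def rat_row_def)
    show "lifts_to_zero p vs s" if "s \<in> set ss" for s
      using that zero by (auto simp: ss_def)
  qed (simp add: vs_def)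
  with v(1,2) show False by (simp add: vec_eq_0_iff_list vs_def)
qed

text \<open>
  A kernel vector \<open>v\<close> at \<open>t\<close> extends to the kernel vector \<open>(v, t v, t\<^sup>2 v)\<close> of the block
  matrix: the upper block row gives \<open>(\<alpha> + t \<beta>) v\<close>, the lower one \<open>t\<close> times that.
\<close>

lemma trivial_kernel_if_check_pencil:
  assumes p: "prime p" and size: "2 * int (2 * B + 2 * n + 3) \<le> p" and S: "S \<le> n"
    and check: "check_pencil p (residue_table p n B) S"
    and v: "v \<in> carrier_vec S" "calR_mat_at S B t *\<^sub>v v = 0\<^sub>v (S + 3)"
  shows "v = 0\<^sub>v S"
proof -
  define T where "T = residue_table p n B"
  note tab = residue_table_nth[OF p size S, folded T_def]
  define vs where "vs = map (($) v) [0..<S]"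
  define ws where "ws = vs @ map ((*) t) vs @ map ((*) t) (map ((*) t) vs)"
  have len: "length (rat_row S B m a) = length vs" for m a by (simp add: rat_row_def vs_def)
  have zeros: "cong_rats p (replicate S 0) (replicate S 0)"
    by (simp add: list_all2_conv_all_nth cong_rat_0[OF p])
  define al where "al a = take S (fst (T ! a))" for a
  define be where "be a = take S (snd (T ! a))" for a
  have al: "cong_rats p (rat_row S B 0 a) (al a)" and be: "cong_rats p (rat_row S B 1 a) (be a)"
    if "a < S + 3" for a
    using tab(2,3)[OF that] by (simp_all add: al_def be_def)
  have T: "take (S + 3) T = map ((!) T) [0..<S + 3]"
    using tab(1) by (auto intro!: nth_equalityI)
  have zero: "lin_form (rat_row S B 0 a) vs + lin_form (rat_row S B 1 a) (map ((*) t) vs) = 0"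
    if "a < S + 3" for a
    using calR_mat_at_mult_vec[OF v(1) that, of B t] v(2) that by (simp add: vs_def lin_form_scale del: map_map)
  have lens: "length (al a) = S" "length (be a) = S" if "a < S + 3" for a
    using al[OF that] be[OF that] by (auto simp: rat_row_def dest!: list_all2_lengthD)
  have top: "lifts_to_zero p ws (al a @ be a @ replicate S 0)" if "a < S + 3" for a
  proof -
    have "lin_form (rat_row S B 0 a @ rat_row S B 1 a @ replicate S 0) ws = 0"
      unfolding ws_def using zero[OF that] len by (simp add: lin_form_append lin_form_zeros)
    then show ?thesis
      unfolding lifts_to_zero_def using al[OF that] be[OF that] zeros
      by (meson list_all2_appendI)
  qed
  have bot: "lifts_to_zero p ws (replicate S 0 @ al a @ be a)" if "a < S + 3" for a
  proof -
    have "lin_form (replicate S 0 @ rat_row S B 0 a @ rat_row S B 1 a) ws =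
      t * (lin_form (rat_row S B 0 a) vs + lin_form (rat_row S B 1 a) (map ((*) t) vs))"
      unfolding ws_def using len
      by (simp add: lin_form_append lin_form_zeros lin_form_scale vs_def algebra_simps del: map_map)
    also have "\<dots> = 0" using zero[OF that] by simp
    finally show ?thesis
      unfolding lifts_to_zero_def using al[OF that] be[OF that] zeros
      by (meson list_all2_appendI)
  qed
  have "\<forall>x\<in>set ws. x = 0"
  proof (rule trivial_kernel_if_full_column_rank_mod[OF _ _ p])
    show "full_column_rank_mod p (3 * S) (map (\<lambda>a. al a @ be a @ replicate S 0) [0..<S + 3] @
        map (\<lambda>a. replicate S 0 @ al a @ be a) [0..<S + 3])"
      using check by (simp add: check_pencil_def T_def[symmetric] T o_def al_def be_def del: upt_Suc)
  next
    fix r assume "r \<in> set (map (\<lambda>a. al a @ be a @ replicate S 0) [0..<S + 3] @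
        map (\<lambda>a. replicate S 0 @ al a @ be a) [0..<S + 3])"
    then show "length r = 3 * S" "lifts_to_zero p ws r"
      using lens top bot by (auto simp del: upt_Suc)
  qed (simp add: ws_def vs_def)
  then have "\<forall>x\<in>set vs. x = 0" by (simp add: ws_def)
  with v(1) show ?thesis by (simp add: vec_eq_0_iff_list vs_def)
qed

lemma minors_gcd_rank_if_check:
  assumes p: "prime p" and size: "2 * int (2 * B + 2 * n + 3) \<le> p" and check: "check_pencils p n B"
    and S: "1 \<le> S" "S \<le> n"
  shows "(\<forall>A. A \<subseteq> {0..S + 2} \<and> card A = S \<longrightarrow> minor_poly S B A \<noteq> 0)
    \<and> Gcd (minor_poly S B ` {A. A \<subseteq> {0..S + 2} \<and> card A = S}) = 1
    \<and> (\<forall>t. vec_space.rank (S + 3) (calR_mat_at S B t) = S)"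
proof -
  have c: "check_minors p (residue_table p n B) S" "check_pencil p (residue_table p n B) S"
    using check S by (auto simp: check_pencils_def Let_def list_all_iff)
  have minor: "\<exists>I\<subseteq>{..<S + 3}. card I = S \<and> det (submatrix (calR_mat_at S B t) I UNIV) \<noteq> 0" for t
    using trivial_kernel_if_check_pencil[OF p size S(2) c(2)]
    by (intro exists_nonzero_maximal_minor calR_mat_at_carrier)
  have "Gcd (minor_poly S B ` {A. A \<subseteq> {0..S + 2} \<and> card A = S}) = 1"
  proof (rule Gcd_rat_polys_eq_1)
    fix t :: complex
    obtain I where "I \<subseteq> {..<S + 3}" "card I = S" "det (submatrix (calR_mat_at S B t) I UNIV) \<noteq> 0"
      using minor by blast
    moreover have "{..<S + 3} = {0..S + 2}" by auto
    ultimately show "\<exists>q\<in>minor_poly S B ` {A. A \<subseteq> {0..S + 2} \<and> card A = S}. poly (map_poly of_rat q) t \<noteq> 0"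
      by (auto simp: poly_minor_poly intro!: imageI)
  qed
  moreover have "vec_space.rank (S + 3) (calR_mat_at S B t) = S" for t
    using minor[of t] rank_if_nonzero_maximal_minor[OF calR_mat_at_carrier] by blast
  ultimately show ?thesis
    using minor_poly_nonzero_if_check_minors[OF p size S(2) c(1)] by blast
qed

section \<open>Computation modulo 257\<close>

text \<open>
  For each \<open>B\<close> all positive \<open>S \<le> 4\<close> with \<open>S < B\<close> are tested. All denominators are
  products of odd numbers up to 141, hence prime to 257, and modulo 257 none of the tested minors and block matrices degenerates;
  for other primes a minor may vanish by accident.
\<close>

lemma check_pencils_2: "check_pencils 257 1 2" by code_simp
lemma check_pencils_3: "check_pencils 257 2 3" by code_simp
lemma check_pencils_4: "check_pencils 257 3 4" by code_simp
lemma check_pencils_5: "check_pencils 257 4 5" by code_simp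
lemma check_pencils_6: "check_pencils 257 4 6" by code_simp
lemma check_pencils_7: "check_pencils 257 4 7" by code_simp
lemma check_pencils_8: "check_pencils 257 4 8" by code_simp
lemma check_pencils_9: "check_pencils 257 4 9" by code_simp
lemma check_pencils_10: "check_pencils 257 4 10" by code_simp
lemma check_pencils_12: "check_pencils 257 4 12" by code_simp
lemma check_pencils_16: "check_pencils 257 4 16" by code_simp
lemma check_pencils_20: "check_pencils 257 4 20" by code_simp
lemma check_pencils_25: "check_pencils 257 4 25" by code_simp
lemma check_pencils_30: "check_pencils 257 4 30" by code_simp

theorem proposition2p1:
  fixes S B :: nat
  assumes "S \<in> {1, 2, 3, 4}"
    and "B \<in> {S + 1, S + 2, S + 3, S + 4, S + 5, S + 6, 12, 16, 20, 25, 30}"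
  shows "(\<forall>A. A \<subseteq> {0..S + 2} \<and> card A = S \<longrightarrow> minor_poly S B A \<noteq> 0)
    \<and> Gcd (minor_poly S B ` {A. A \<subseteq> {0..S + 2} \<and> card A = S}) = 1
    \<and> (\<forall>t::complex. vec_space.rank (S + 3) (calR_mat_at S B t) = S)
    \<and> vec_space.rank (S + 3) (calR_mat_at S B (of_real catalan_const)) = S"
proof -
  define n where "n = min 4 (B - 1)"
  have B: "B \<in> {2, 3, 4, 5, 6, 7, 8, 9, 10, 12, 16, 20, 25, 30}"
    using assms by auto
  have S: "1 \<le> S" "S \<le> n" using assms by (auto simp: n_def)
  have "prime (257 :: int)" by simp
  moreover have "2 * int (2 * B + 2 * n + 3) \<le> 257"
    using B by (auto simp: n_def)
  moreover have "check_pencils 257 n B"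
    using B
      check_pencils_2 check_pencils_3 check_pencils_4 check_pencils_5 check_pencils_6
      check_pencils_7 check_pencils_8 check_pencils_9 check_pencils_10 check_pencils_12
      check_pencils_16 check_pencils_20 check_pencils_25 check_pencils_30
    by (auto simp: n_def)
  ultimately show ?thesis
    using minors_gcd_rank_if_check[OF _ _ _ S] by blast
qed

end
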